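(* For every $q\in(0,1)$ there is a constant $C>0$ such that for all $\varepsilon\in(0,1/2)$ and all integers $n\ge2$, $\lceil C\log(1/\varepsilon)\,n^{3/2}\log n\rceil$ traces from the deletion channel with deletion probability $q$ suffice to distinguish between $\mathbf x_n := (01)^{n-1}\,10\,(01)^n$ and $\mathbf y_n := (01)^n\,10\,(01)^{n-1}$ with probability at least $1-\varepsilon$.
   Context: Here $(b)^m$ denotes the concatenation of $m$ copies of the string $b$, so $\mathbf x_n,\mathbf y_n\in\{0,1\}^{4n}$; $\log$ is the natural logarithm. The deletion channel with deletion probability $q$ takes an input string $\mathbf x\in\{0,1\}^N$, deletes each bit independently with probability $q$, and outputs the concatenation, in order, of the retained bits; the random output is called a trace. Let $\mathcal S=\bigcup_{k\ge0}\{0,1\}^k$. Let $\mathbf P_{\mathbf x}$ denote probability when $\mathfrak X\in\mathcal S^T$ consists of $T$ independent traces of $\mathbf x$. Strings $\mathbf x,\mathbf y\in\{0,1\}^N$ can be distinguished with probability at least $1-\varepsilon$ from $T$ traces if there is a function $G:\mathcal S^T\to\{0,1\}^N$ such that $\mathbf P_{\mathbf x}[G(\mathfrak X)=\mathbf x]\ge 1-\varepsilon$ and $\mathbf P_{\mathbf y}[G(\mathfrak X)=\mathbf y]\ge 1-\varepsilon$. *)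

theory Defs
  imports "HOL-Probability.Probability"
begin

text \<open>Bits are booleans, with 0 and 1 rendered as \<^const>\<open>False\<close> and \<^const>\<open>True\<close>; a string in
  $\{0,1\}^N$ is a list of length $N$.\<close>

type_synonym bits = "bool list"

text \<open>The coordinates of \<open>keep\<close> are independent, and bit \<open>i\<close> is retained (\<open>keep i\<close>) with
  probability \<open>1 - q\<close>. Meaningful for \<open>0 \<le> q \<le> 1\<close>.\<close>

definition trace_pmf :: "real \<Rightarrow> bits \<Rightarrow> bits pmf" where
  "trace_pmf q x =
     map_pmf (\<lambda>keep. nths x {i. keep i})
       (Pi_pmf {..<length x} False (\<lambda>_. bernoulli_pmf (1 - q)))"

text \<open>An element of $\mathcal{S}^T$ is a list of \<open>T\<close> strings; \<^const>\<open>replicate_pmf\<close> draws its entries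
  independently.\<close>

definition traces_pmf :: "real \<Rightarrow> nat \<Rightarrow> bits \<Rightarrow> bits list pmf" where
  "traces_pmf q T x = replicate_pmf T (trace_pmf q x)"

definition distinguishable :: "real \<Rightarrow> real \<Rightarrow> nat \<Rightarrow> bits \<Rightarrow> bits \<Rightarrow> bool" where
  "distinguishable q \<epsilon> T x y \<longleftrightarrow>
     length x = length y \<and>
     (\<exists>G :: bits list \<Rightarrow> bits.
        G \<in> {X. length X = T} \<rightarrow> {z. length z = length x} \<and>
        measure_pmf.prob (traces_pmf q T x) {X. G X = x} \<ge> 1 - \<epsilon> \<and>
        measure_pmf.prob (traces_pmf q T y) {X. G X = y} \<ge> 1 - \<epsilon>)"

definition string_power :: "bits \<Rightarrow> nat \<Rightarrow> bits" where
  "string_power b m = concat (replicate m b)"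

definition x_string :: "nat \<Rightarrow> bits" where
  "x_string n =
     string_power [False, True] (n - 1) @ [True, False] @ string_power [False, True] n"

definition y_string :: "nat \<Rightarrow> bits" where
  "y_string n =
     string_power [False, True] n @ [True, False] @ string_power [False, True] (n - 1)"

lemma length_string_power: "length (string_power b m) = m * length b"
  by (induction m) (simp_all add: string_power_def)

lemma length_x_string: "n \<ge> 1 \<Longrightarrow> length (x_string n) = 4 * n"
  by (simp add: x_string_def length_string_power)

lemma length_y_string: "n \<ge> 1 \<Longrightarrow> length (y_string n) = 4 * n"
  by (simp add: y_string_def length_string_power)

end

theory Submission
  imports Defs "HOL-Real_Asymp.Real_Asymp"
begin

text \<open>Both strings are alternating except for a block \<open>10\<close>, which sits at position $s=2n-2$ in one string
  and at $s+2$ in the other. In a trace the defect shows up near position $(1-q)s$, up to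
  fluctuations of order $\sqrt n$, as an excess of equal neighbouring bits. Weight the centred agreement
  indicators of a trace by a function of the position that has slope $-1/A$ on a window of width
  $A\asymp\sqrt n$ around $(1-q)s$ and vanishes outside a multiple of that window. The means under the
  two strings then differ by a constant times $1/A$, while the second moment is $O(A)$, because the
  centred indicators are uncorrelated up to exponentially decaying effects of the defect and of the
  end of the string. By a Bernstein bound, $O(A/A^{-2})=O(n^{3/2})$ traces suffice up to the factor
  $\log(1/\varepsilon)$. The finitely many small \<open>n\<close> are covered by testing whether a trace equals the
  whole input.\<close>

subsection \<open>Testing with a real statistic\<close>

text \<open>For negative \<open>x\<close> put \<open>y = - x\<close>; the claim becomes
  \<open>1 \<le> (1 - y + y\<^sup>2) * exp y\<close>, and the quadratic Taylor polynomial of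
  \<open>exp y\<close> already brings the product above 1.\<close>

lemma exp_le_quadratic:
  fixes x :: real
  assumes "x \<le> 1"
  shows "exp x \<le> 1 + x + x\<^sup>2"
proof (cases "x \<ge> 0")
  case True
  then show ?thesis using assms by (rule exp_bound)
next
  case False
  define y where "y = - x"
  have y: "y \<ge> 0" using False by (simp add: y_def)
  have "1 \<le> 1 + (y\<^sup>2 + y ^ 3 + y ^ 4) / 2" using y by simp
  also have "\<dots> = (1 - y + y\<^sup>2) * (1 + y + y\<^sup>2 / 2)"
    by (simp add: field_simps power2_eq_square power3_eq_cube power4_eq_xxxx)
  also have "\<dots> \<le> (1 - y + y\<^sup>2) * exp y"
  proof (rule mult_left_mono)
    show "1 + y + y\<^sup>2 / 2 \<le> exp y" using exp_lower_Taylor_quadratic[OF y] .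
    have "0 \<le> (1 - y / 2)\<^sup>2 + 3 / 4 * y\<^sup>2" by simp
    also have "\<dots> = 1 - y + y\<^sup>2" by (simp add: power2_eq_square field_simps)
    finally show "0 \<le> 1 - y + y\<^sup>2" .
  qed
  finally have "exp (- y) \<le> 1 - y + y\<^sup>2" by (simp add: exp_minus field_simps)
  then show ?thesis by (simp add: y_def)
qed

lemma finite_set_replicate_pmf:
  "finite (set_pmf P) \<Longrightarrow> finite (set_pmf (replicate_pmf T P))"
  by (induction T) auto

lemma expectation_bind_pmf_finite:
  fixes h :: "'b \<Rightarrow> real"
  assumes "finite (set_pmf p)" "\<And>a. a \<in> set_pmf p \<Longrightarrow> finite (set_pmf (f a))"
  shows "measure_pmf.expectation (p \<bind> f) h =
    measure_pmf.expectation p (\<lambda>a. measure_pmf.expectation (f a) h)"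
  by (subst pmf_expectation_bind[OF assms(1)], use assms in auto)
     (simp add: integral_measure_pmf[OF assms(1)])

lemma expectation_prod_list_replicate_pmf:
  fixes g :: "'a \<Rightarrow> real"
  assumes "finite (set_pmf P)"
  shows "measure_pmf.expectation (replicate_pmf T P) (\<lambda>X. prod_list (map g X)) =
    measure_pmf.expectation P g ^ T"
proof (induction T)
  case (Suc T)
  have fin: "finite (set_pmf (replicate_pmf T P))"
    using assms by (rule finite_set_replicate_pmf)
  show ?case
    using assms fin Suc
    by (simp add: expectation_bind_pmf_finite flip: map_pmf_def)
qed simp

lemma exp_sum_list: "exp (sum_list xs :: real) = prod_list (map exp xs)"
  by (induction xs) (simp_all add: exp_add)

text \<open>Chernoff's method: Markov's inequality for \<open>exp (l * S)\<close> together with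
  independence. The condition \<open>t * M \<le> 2 * V\<close> keeps \<open>l * S a\<close> below 1,
  where the quadratic bound on \<open>exp\<close> turns the second moment into the estimate
  \<open>exp (l\<^sup>2 * V)\<close> of the moment generating function.\<close>

lemma prob_replicate_pmf_sum_ge:
  fixes S :: "'a \<Rightarrow> real"
  assumes fin: "finite (set_pmf P)"
    and mean: "measure_pmf.expectation P S \<le> 0"
    and var: "measure_pmf.expectation P (\<lambda>a. (S a)\<^sup>2) \<le> V"
    and bound: "\<And>a. a \<in> set_pmf P \<Longrightarrow> S a \<le> M"
    and t: "t > 0" "t * M \<le> 2 * V" and V: "V > 0"
  shows "measure_pmf.prob (replicate_pmf T P) {X. sum_list (map S X) \<ge> real T * t}
    \<le> exp (- (real T * t\<^sup>2 / (4 * V)))"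
proof -
  \<comment> \<open>The minimiser of \<open>l\<^sup>2 * V - l * t\<close>, with minimum
    \<open>- (t\<^sup>2 / (4 * V))\<close>.\<close>
  define l where "l = t / (2 * V)"
  have l: "l > 0" using t V by (simp add: l_def)
  let ?E = "measure_pmf.expectation (replicate_pmf T P)"
  have fin': "finite (set_pmf (replicate_pmf T P))"
    using fin by (rule finite_set_replicate_pmf)
  have int: "integrable (measure_pmf P) f" for f :: "'a \<Rightarrow> real"
    using fin by (rule integrable_measure_pmf_finite)
  have "measure_pmf.expectation P (\<lambda>a. exp (l * S a))
      \<le> measure_pmf.expectation P (\<lambda>a. 1 + l * S a + l\<^sup>2 * (S a)\<^sup>2)"
  proof (rule integral_mono_AE)
    show "AE a in measure_pmf P. exp (l * S a) \<le> 1 + l * S a + l\<^sup>2 * (S a)\<^sup>2"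
    proof (rule AE_pmfI)
      fix a assume "a \<in> set_pmf P"
      then have "l * S a \<le> l * M" using bound l by simp
      also have "\<dots> \<le> 1" using t V by (simp add: l_def)
      finally show "exp (l * S a) \<le> 1 + l * S a + l\<^sup>2 * (S a)\<^sup>2"
        using exp_le_quadratic[of "l * S a"] by (simp add: power_mult_distrib)
    qed
  qed (auto intro: int)
  also have "\<dots> = 1 + l * measure_pmf.expectation P S
      + l\<^sup>2 * measure_pmf.expectation P (\<lambda>a. (S a)\<^sup>2)"
    by (simp add: int)
  also have "\<dots> \<le> 1 + 0 + l\<^sup>2 * V"
    using mean var l by (intro add_mono mult_left_mono) (auto simp: mult_nonneg_nonpos)
  also have "\<dots> \<le> exp (l\<^sup>2 * V)" by simp
  finally have mgf: "measure_pmf.expectation P (\<lambda>a. exp (l * S a)) \<le> exp (l\<^sup>2 * V)" .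
  have eq: "exp (l * sum_list (map S X)) = prod_list (map (\<lambda>a. exp (l * S a)) X)" for X
    by (simp add: exp_sum_list o_def flip: sum_list_const_mult)
  have "measure_pmf.prob (replicate_pmf T P) {X. sum_list (map S X) \<ge> real T * t}
      \<le> ?E (\<lambda>X. exp (l * sum_list (map S X) - l * (real T * t)))"
  proof -
    have "measure_pmf.prob (replicate_pmf T P) {X. sum_list (map S X) \<ge> real T * t}
      = ?E (indicator {X. sum_list (map S X) \<ge> real T * t})" by simp
    also have "\<dots> \<le> ?E (\<lambda>X. exp (l * sum_list (map S X) - l * (real T * t)))"
      by (rule integral_mono) (use l in \<open>auto simp: indicator_def
            intro!: integrable_measure_pmf_finite[OF fin']\<close>)
    finally show ?thesis .
  qed
  also have "\<dots> = ?E (\<lambda>X. exp (l * sum_list (map S X))) / exp (l * (real T * t))"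
    by (simp add: exp_diff)
  also have "?E (\<lambda>X. exp (l * sum_list (map S X))) =
      measure_pmf.expectation P (\<lambda>a. exp (l * S a)) ^ T"
    unfolding eq by (rule expectation_prod_list_replicate_pmf[OF fin])
  also have "\<dots> / exp (l * (real T * t)) \<le> exp (l\<^sup>2 * V) ^ T / exp (l * (real T * t))"
    by (intro divide_right_mono power_mono mgf) auto
  also have "\<dots> = exp (real T * (l\<^sup>2 * V) - l * (real T * t))"
    by (simp add: exp_diff exp_of_nat_mult)
  also have "real T * (l\<^sup>2 * V) - l * (real T * t) = - (real T * t\<^sup>2 / (4 * V))"
    using V by (simp add: l_def field_simps power2_eq_square)
  finally show ?thesis .
qed

section \<open>The trace distribution by recursion on the input string\<close>

lemma trace_pmf_Nil: "trace_pmf q [] = return_pmf []"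
  by (simp add: trace_pmf_def)

text \<open>Coordinate 0 of \<open>keep\<close> decides about \<open>a\<close> independently of the
  others, and shifting these by \<open>Suc\<close> gives a trace of \<open>x\<close>. Every later
  induction over the input rests on this recursion.\<close>

lemma trace_pmf_Cons:
  "trace_pmf q (a # x) = bernoulli_pmf (1 - q) \<bind>
    (\<lambda>b. map_pmf (\<lambda>t. if b then a # t else t) (trace_pmf q x))"
proof -
  let ?B = "\<lambda>_::nat. bernoulli_pmf (1 - q)"
  have set: "{..<length (a # x)} = insert 0 (Suc ` {..<length x})"
    by (auto simp: lessThan_Suc_eq_insert_0)
  have shift: "Pi_pmf {..<length x} False ?B =
      map_pmf (\<lambda>g. g \<circ> Suc) (Pi_pmf (Suc ` {..<length x}) False ?B)"
    by (rule Pi_pmf_bij_betw) (auto simp: bij_betw_def)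
  have nths: "nths (a # x) {i. (f(0 := b)) i} = (if b then a # nths x {i. (f \<circ> Suc) i}
      else nths x {i. (f \<circ> Suc) i})" for f b
    by (simp add: nths_Cons)
  show ?thesis
    unfolding trace_pmf_def set
    by (subst Pi_pmf_insert')
       (simp_all add: shift nths map_pmf_def bind_assoc_pmf bind_return_pmf del: fun_upd_apply)
qed

lemma finite_set_trace_pmf: "finite (set_pmf (trace_pmf q x))"
  by (induction x) (auto simp: trace_pmf_Nil trace_pmf_Cons)

lemma expectation_trace_pmf_Cons:
  fixes h :: "bits \<Rightarrow> real"
  assumes "0 \<le> q" "q \<le> 1"
  shows "measure_pmf.expectation (trace_pmf q (a # x)) h =
    (1 - q) * measure_pmf.expectation (trace_pmf q x) (\<lambda>t. h (a # t)) +
    q * measure_pmf.expectation (trace_pmf q x) h"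
  using assms
  by (simp add: trace_pmf_Cons expectation_bind_pmf_finite finite_set_trace_pmf
      integral_bernoulli_pmf)

lemma self_in_trace_pmf: "q < 1 \<Longrightarrow> 0 \<le> q \<Longrightarrow> x \<in> set_pmf (trace_pmf q x)"
  by (induction x) (auto simp: trace_pmf_Nil trace_pmf_Cons set_pmf_iff intro!: bexI[of _ True])

lemma length_trace_le: "t \<in> set_pmf (trace_pmf q x) \<Longrightarrow> length t \<le> length x"
proof -
  assume "t \<in> set_pmf (trace_pmf q x)"
  then have "subseq t x" by (auto simp: trace_pmf_def subseq_conv_nths)
  then show ?thesis by (rule list_emb_length)
qed

lemma trace_same_length:
  assumes "t \<in> set_pmf (trace_pmf q x)" "length t = length x"
  shows "t = x"
proof -
  have "subseq t x"
    using assms(1) by (auto simp: trace_pmf_def subseq_conv_nths)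
  then show ?thesis using assms(2) by (rule subseq_same_length)
qed

text \<open>The test compares the sum of \<open>S\<close> over all traces with \<open>T\<close>
  times the midpoint \<open>m\<close> of the two means. An error forces the empirical mean to
  deviate by at least \<delta>/2 from its expectation, which has probability at most
  \<open>exp (- (T * \<delta>\<^sup>2 / (16 * V)))\<close>.\<close>

lemma distinguishable_of_statistic:
  fixes S :: "bits \<Rightarrow> real"
  assumes len: "length x = length y"
    and bound: "\<And>t. length t \<le> length x \<Longrightarrow> \<bar>S t\<bar> \<le> M"
    and varx: "measure_pmf.expectation (trace_pmf q x) (\<lambda>t. (S t)\<^sup>2) \<le> V"
    and vary: "measure_pmf.expectation (trace_pmf q y) (\<lambda>t. (S t)\<^sup>2) \<le> V"
    and diff: "measure_pmf.expectation (trace_pmf q x) S -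
        measure_pmf.expectation (trace_pmf q y) S \<ge> \<delta>"
    and \<delta>: "\<delta> > 0" "\<delta> * M \<le> 2 * V" and V: "V > 0"
    and \<epsilon>: "0 < \<epsilon>"
    and T: "real T \<ge> 16 * V / \<delta>\<^sup>2 * ln (1 / \<epsilon>)"
  shows "distinguishable q \<epsilon> T x y"
proof -
  let ?E = "\<lambda>z. measure_pmf.expectation (trace_pmf q z)"
  define m where "m = (?E x S + ?E y S) / 2"
  define G where "G X = (if sum_list (map S X) > real T * m then x else y)" for X
  have int: "integrable (measure_pmf (trace_pmf q z)) f" for f :: "bits \<Rightarrow> real" and z
    using finite_set_trace_pmf by (rule integrable_measure_pmf_finite)
  have absE: "\<bar>?E z S\<bar> \<le> M" if "length z = length x" for z
  proof -
    have "\<bar>?E z S\<bar> \<le> ?E z (\<lambda>t. \<bar>S t\<bar>)" by (rule integral_abs_bound)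
    also have "\<dots> \<le> ?E z (\<lambda>t. M)" proof (rule integral_mono_AE)
      show "AE t in measure_pmf (trace_pmf q z). \<bar>S t\<bar> \<le> M"
        using bound length_trace_le that by (metis AE_pmfI)
    qed (rule int)+
    finally show ?thesis by simp
  qed
  \<comment> \<open>The sign \<open>c\<close> treats both directions at once: -1 for the lower tail
    under \<open>x\<close>, 1 for the upper tail under \<open>y\<close>. Centring at most doubles
    the range to \<open>2 * M\<close> and does not increase the second moment.\<close>
  have tail: "measure_pmf.prob (traces_pmf q T z)
      {X. sum_list (map (\<lambda>t. c * (S t - ?E z S)) X) \<ge> real T * (\<delta> / 2)} \<le> \<epsilon>"
    if c: "\<bar>c\<bar> = 1" and z: "length z = length x" and v: "?E z (\<lambda>t. (S t)\<^sup>2) \<le> V" for c z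
  proof -
    have "measure_pmf.prob (traces_pmf q T z)
        {X. sum_list (map (\<lambda>t. c * (S t - ?E z S)) X) \<ge> real T * (\<delta> / 2)}
        \<le> exp (- (real T * (\<delta> / 2)\<^sup>2 / (4 * V)))"
      unfolding traces_pmf_def
    proof (rule prob_replicate_pmf_sum_ge[where M = "2 * M"])
      have c2: "c\<^sup>2 = 1" using c by (metis one_power2 power2_abs)
      have "?E z (\<lambda>t. (c * (S t - ?E z S))\<^sup>2) =
          ?E z (\<lambda>t. (S t)\<^sup>2 - 2 * ?E z S * S t + (?E z S)\<^sup>2)"
        by (intro Bochner_Integration.integral_cong)
           (auto simp: power_mult_distrib c2 power2_diff)
      also have "\<dots> = ?E z (\<lambda>t. (S t)\<^sup>2) - (?E z S)\<^sup>2"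
        by (simp add: int power2_eq_square)
      also have "\<dots> \<le> V" using v by (smt (verit) zero_le_power2)
      finally show "?E z (\<lambda>t. (c * (S t - ?E z S))\<^sup>2) \<le> V" .
      fix t
      assume "t \<in> set_pmf (trace_pmf q z)"
      then have "length t \<le> length x" using length_trace_le z by metis
      then have St: "\<bar>S t\<bar> \<le> M" by (rule bound)
      have "c * (S t - ?E z S) \<le> \<bar>c * (S t - ?E z S)\<bar>" by simp
      also have "\<dots> = \<bar>S t - ?E z S\<bar>" using c by (simp add: abs_mult)
      also have "\<dots> \<le> 2 * M" using St absE[OF z] by linarith
      finally show "c * (S t - ?E z S) \<le> 2 * M" .
    qed (use \<delta> V in \<open>auto simp: int finite_set_trace_pmf\<close>)
    also have "ln (1 / \<epsilon>) \<le> real T * (\<delta> / 2)\<^sup>2 / (4 * V)"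
      using T \<delta> V by (simp add: field_simps power2_eq_square)
    then have "exp (- (real T * (\<delta> / 2)\<^sup>2 / (4 * V))) \<le> exp (- ln (1 / \<epsilon>))" by simp
    also have "\<dots> = \<epsilon>" using \<epsilon> by (simp add: ln_div)
    finally show ?thesis .
  qed
  have centre: "sum_list (map (\<lambda>t. c * (S t - e)) X) = c * (sum_list (map S X) - real (length X) * e)"
    for c e X by (induction X) (simp_all add: algebra_simps)
  have len_T: "length X = T" if "X \<in> set_pmf (traces_pmf q T z)" for X z
    using that by (simp add: traces_pmf_def set_replicate_pmf)
  have good: "measure_pmf.prob (traces_pmf q T z) {X. G X = z} \<ge> 1 - \<epsilon>"
    if c: "\<bar>c\<bar> = 1" and z: "length z = length x" and v: "?E z (\<lambda>t. (S t)\<^sup>2) \<le> V"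
      and bad: "\<And>X. length X = T \<Longrightarrow> G X \<noteq> z \<Longrightarrow>
        c * (sum_list (map S X) - real T * ?E z S) \<ge> real T * (\<delta> / 2)" for c z
  proof -
    have "measure_pmf.prob (traces_pmf q T z) (- {X. G X = z}) \<le>
        measure_pmf.prob (traces_pmf q T z)
          {X. sum_list (map (\<lambda>t. c * (S t - ?E z S)) X) \<ge> real T * (\<delta> / 2)}"
      by (rule measure_pmf.finite_measure_mono_AE)
         (use bad len_T in \<open>auto simp del: times_divide_eq_right simp: AE_measure_pmf_iff centre\<close>)
    also have "\<dots> \<le> \<epsilon>" using tail[OF c z v] .
    finally show ?thesis
      by (simp add: measure_pmf.prob_compl[of "{X. G X = z}", simplified, folded Compl_eq_Diff_UNIV])
  qed
  have "measure_pmf.prob (traces_pmf q T x) {X. G X = x} \<ge> 1 - \<epsilon>"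
  proof (rule good[of "-1"])
    fix X assume "length X = T" "G X \<noteq> x"
    then have "sum_list (map S X) \<le> real T * m" by (auto simp: G_def split: if_splits)
    also have "\<dots> \<le> real T * (?E x S - \<delta> / 2)"
      using diff by (intro mult_left_mono) (auto simp: m_def field_simps)
    finally show "- 1 * (sum_list (map S X) - real T * ?E x S) \<ge> real T * (\<delta> / 2)"
      by (simp add: algebra_simps)
  qed (use varx in auto)
  moreover have "measure_pmf.prob (traces_pmf q T y) {X. G X = y} \<ge> 1 - \<epsilon>"
  proof (rule good[of 1])
    fix X assume "length X = T" "G X \<noteq> y"
    have "real T * (?E y S + \<delta> / 2) \<le> real T * m"
      using diff by (intro mult_left_mono) (auto simp: m_def field_simps)
    also have "\<dots> \<le> sum_list (map S X)" using \<open>G X \<noteq> y\<close> by (auto simp: G_def split: if_splits)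
    finally show "1 * (sum_list (map S X) - real T * ?E y S) \<ge> real T * (\<delta> / 2)"
      by (simp add: algebra_simps)
  qed (use vary len in auto)
  moreover have "G \<in> {X. length X = T} \<rightarrow> {z. length z = length x}"
    using len by (auto simp: G_def)
  ultimately show ?thesis using len unfolding distinguishable_def by blast
qed

text \<open>The statistic is the indicator of the trace being \<open>x\<close> itself. Its mean is
  positive under \<open>x\<close> and zero under \<open>y\<close>, because a trace of full length
  equals its input. The constant depends on the strings, so this serves only finitely many
  pairs.\<close>

lemma ex_statistic_sample_bound:
  assumes q: "0 < q" "q < 1" and len: "length x = length y" and ne: "x \<noteq> y"
  shows "\<exists>D>0. \<forall>\<epsilon> T. 0 < \<epsilon> \<longrightarrow> real T \<ge> D * ln (1 / \<epsilon>) \<longrightarrow> distinguishable q \<epsilon> T x y"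
proof -
  define S :: "bits \<Rightarrow> real" where "S = indicator {x}"
  define \<delta> where "\<delta> = pmf (trace_pmf q x) x"
  have \<delta>: "0 < \<delta>" "\<delta> \<le> 1"
    using self_in_trace_pmf[of q x] q by (auto simp: \<delta>_def pmf_le_1 pmf_positive)
  have S2: "(\<lambda>t. (S t)\<^sup>2) = S" by (auto simp: S_def indicator_def)
  have Ex: "measure_pmf.expectation (trace_pmf q x) S = \<delta>"
    by (simp add: S_def \<delta>_def measure_pmf_single)
  have "x \<notin> set_pmf (trace_pmf q y)" using trace_same_length len ne by metis
  then have Ey: "measure_pmf.expectation (trace_pmf q y) S = 0"
    by (simp add: S_def measure_pmf_single set_pmf_iff)
  show ?thesis
  proof (intro exI[of _ "16 * 1 / \<delta>\<^sup>2"] conjI allI impI)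
    fix \<epsilon> :: real and T :: nat
    assume "0 < \<epsilon>" "real T \<ge> 16 * 1 / \<delta>\<^sup>2 * ln (1 / \<epsilon>)"
    then show "distinguishable q \<epsilon> T x y"
      by (intro distinguishable_of_statistic[where S = S and M = 1 and V = 1 and \<delta> = \<delta>])
         (use len ne \<delta> in \<open>auto simp: S2 Ex Ey, auto simp: S_def indicator_def\<close>)
  qed (use \<delta> in simp)
qed

subsection \<open>The weight function\<close>

definition tent :: "real \<Rightarrow> real \<Rightarrow> real" where
  "tent A d = max 0 (1 - \<bar>d\<bar> / A)"

text \<open>Slope \<open>-1/A\<close> within distance \<open>A\<close> of \<open>c\<close>, where the defect is typically found, and support of
  length \<open>4 * A\<close>, which keeps the variance of order \<open>A\<close>.\<close>

definition weight :: "real \<Rightarrow> real \<Rightarrow> nat \<Rightarrow> real" where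
  "weight c A j = tent A (real j - c + A) - tent A (real j - c - A)"

lemma abs_weight_le:
  assumes "A > 0" shows "\<bar>weight c A j\<bar> \<le> 1"
proof -
  have "0 \<le> tent A d" "tent A d \<le> 1" for d using assms by (auto simp: tent_def)
  from this[of "real j - c + A"] this[of "real j - c - A"] show ?thesis
    unfolding weight_def by linarith
qed

lemma weight_eq_0:
  assumes "A > 0" "\<bar>real j - c\<bar> \<ge> 2 * A"
  shows "weight c A j = 0"
proof -
  have "\<bar>real j - c + A\<bar> \<ge> A" "\<bar>real j - c - A\<bar> \<ge> A" using assms by linarith+
  then show ?thesis using assms by (simp add: weight_def tent_def max_def)
qed

lemma tent_diff_le:
  assumes "A > 0" shows "\<bar>tent A d - tent A (d + 1)\<bar> \<le> 1 / A"
proof -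
  have "\<bar>\<bar>d\<bar> / A - \<bar>d + 1\<bar> / A\<bar> \<le> 1 / A"
    using assms by (simp add: field_simps abs_le_iff) linarith
  then show ?thesis unfolding tent_def by linarith
qed

text \<open>Close to \<open>c\<close> the rescaled slope is exactly 1. Further out the error is at
  most 3, and there \<open>\<bar>real j - c\<bar> \<ge> A / 2\<close> makes the right-hand side at
  least 3. A quadratic majorant is convenient because its binomial mean is explicit.\<close>

lemma weight_step:
  assumes A: "A \<ge> 2"
  shows "\<bar>A * (weight c A j - weight c A (Suc j)) - 1\<bar> \<le> 12 * (real j - c)\<^sup>2 / A\<^sup>2"
proof (cases "\<bar>real j - c\<bar> \<le> A - 1")
  case True
  define d where "d = real j - c"
  have inside: "tent A (e + A) - tent A (e - A) = - e / A" if "\<bar>e\<bar> \<le> A" for e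
  proof -
    have "\<bar>e + A\<bar> / A = e / A + 1" "\<bar>e - A\<bar> / A = 1 - e / A"
      using that A by (simp_all add: field_simps)
    then show ?thesis by (simp add: tent_def max_def)
  qed
  have "\<bar>d\<bar> \<le> A" "\<bar>d + 1\<bar> \<le> A" using True by (auto simp: d_def)
  moreover have "real j - c = d" "real (Suc j) - c = d + 1" by (simp_all add: d_def)
  ultimately have "weight c A j - weight c A (Suc j) = - d / A - - (d + 1) / A"
    unfolding weight_def by (simp only: inside)
  also have "\<dots> = 1 / A" using A by (simp add: field_simps)
  finally have "A * (weight c A j - weight c A (Suc j)) = 1" using A by simp
  then show ?thesis by simp
next
  case False
  then have "\<bar>real j - c\<bar> \<ge> A / 2" using A by linarith
  then have "(A / 2)\<^sup>2 \<le> (real j - c)\<^sup>2"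
    using A by (metis abs_le_square_iff abs_of_nonneg divide_nonneg_nonneg order.trans zero_le_numeral)
  then have "3 \<le> 12 * (real j - c)\<^sup>2 / A\<^sup>2"
    using A by (simp add: power_divide field_simps)
  moreover have "\<bar>A * (weight c A j - weight c A (Suc j))\<bar> \<le> 2"
  proof -
    have "\<bar>weight c A j - weight c A (Suc j)\<bar> \<le> 2 / A"
      using tent_diff_le[of A "real j - c + A"] tent_diff_le[of A "real j - c - A"] A
      by (simp add: weight_def algebra_simps)
    then have "A * \<bar>weight c A j - weight c A (Suc j)\<bar> \<le> 2" using A by (simp add: field_simps)
    then show ?thesis using A by (metis abs_mult abs_of_nonneg order.trans zero_le_numeral)
  qed
  ultimately show ?thesis by linarith
qed

text \<open>The support meets at most \<open>4 * A + 1\<close> integers, and each weight is at most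
  1 in absolute value.\<close>

lemma sum_abs_weight_le:
  assumes A: "A \<ge> 1"
  shows "(\<Sum>j<n. \<bar>weight c A j\<bar>) \<le> 5 * A"
proof -
  let ?J = "{\<lceil>c - 2 * A\<rceil>..\<lfloor>c + 2 * A\<rfloor>}"
  let ?I = "{j\<in>{..<n}. int j \<in> ?J}"
  have "(\<Sum>j<n. \<bar>weight c A j\<bar>) = (\<Sum>j\<in>?I. \<bar>weight c A j\<bar>)"
  proof (rule sum.mono_neutral_right)
    show "\<forall>j\<in>{..<n} - ?I. \<bar>weight c A j\<bar> = 0"
    proof
      fix j assume "j \<in> {..<n} - ?I"
      then have "\<not> (c - 2 * A \<le> real j \<and> real j \<le> c + 2 * A)"
        by (auto simp: ceiling_le_iff le_floor_iff)
      then have "\<bar>real j - c\<bar> \<ge> 2 * A" by linarith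
      then show "\<bar>weight c A j\<bar> = 0" using A weight_eq_0 by simp
    qed
  qed auto
  also have "\<dots> \<le> (\<Sum>j\<in>?I. 1)"
    using A by (intro sum_mono abs_weight_le) auto
  also have "\<dots> = real (card (int ` ?I))"
    by (simp add: card_image)
  also have "\<dots> \<le> real (card ?J)"
    by (intro of_nat_mono card_mono) auto
  also have "\<dots> \<le> 4 * A + 1"
    using A by (simp add: card_atLeastAtMost_int) linarith
  also have "\<dots> \<le> 5 * A" using A by simp
  finally show ?thesis .
qed

subsection \<open>Weighted agreements in a trace\<close>

lemma string_power_append: "string_power b (m + n) = string_power b m @ string_power b n"
  by (induction m) (simp_all add: string_power_def)

text \<open>In this form both strings have the same two flanks \<open>(01)^m\<close> and differ only
  in complementary blocks of four bits, 1001 against 0110.\<close>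

lemma x_string_Suc:
  "x_string (Suc m) = string_power [False, True] m @ [True, False, False, True] @ string_power [False, True] m"
  by (simp add: x_string_def string_power_def)

lemma y_string_Suc:
  "y_string (Suc m) = string_power [False, True] m @ [False, True, True, False] @ string_power [False, True] m"
  using string_power_append[of "[False, True]" m 1] by (simp add: y_string_def string_power_def)

lemma x_string_neq_y_string: "n \<ge> 1 \<Longrightarrow> x_string n \<noteq> y_string n"
  by (cases n) (simp_all add: x_string_Suc y_string_Suc)

locale deletion =
  fixes q :: real
  assumes q0: "0 < q" and q1: "q < 1"
begin

abbreviation E :: "bits \<Rightarrow> (bits \<Rightarrow> real) \<Rightarrow> real" where
  "E x h \<equiv> measure_pmf.expectation (trace_pmf q x) h"

text \<open>In the trace of an infinite alternating string the agreements of consecutive bits are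
  independent with probability $q/(1+q)$, so \<open>agree\<close> is centred there.\<close>

definition agree :: "bool \<Rightarrow> bool \<Rightarrow> real" where
  "agree a b = of_bool (a = b) - q / (1 + q)"

text \<open>The index \<open>i\<close> is the position of the current head in the trace, so the
  weights depend on positions in the trace and not in the input.\<close>

fun stat :: "(nat \<Rightarrow> real) \<Rightarrow> nat \<Rightarrow> bits \<Rightarrow> real" where
  "stat f i (a # b # t) = f i * agree a b + stat f (Suc i) (b # t)"
| "stat f i _ = 0"

text \<open>Mean of \<open>agree a b\<close> for the first retained bit \<open>b\<close> of the string, counted as 0 if there is
  none.\<close>

fun next_agree :: "bool \<Rightarrow> bits \<Rightarrow> real" where
  "next_agree a [] = 0"
| "next_agree a (b # x) = (1 - q) * agree a b + q * next_agree a x"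

text \<open>Mean of \<open>f (i + N)\<close> for \<open>N\<close> binomial with parameters \<open>k\<close> and \<open>1 - q\<close>.\<close>

fun binomial_mean :: "(nat \<Rightarrow> real) \<Rightarrow> nat \<Rightarrow> nat \<Rightarrow> real" where
  "binomial_mean f 0 i = f i"
| "binomial_mean f (Suc k) i = (1 - q) * binomial_mean f k (Suc i) + q * binomial_mean f k i"

text \<open>A bound on the mean of the statistic over the trace of the string, uniform in the
  starting position and in all weights bounded by 1.\<close>

fun drift :: "bits \<Rightarrow> real" where
  "drift [] = 0"
| "drift (a # x) = \<bar>next_agree a x\<bar> + drift x"

section \<open>First and second moments of the statistic\<close>

lemma integrable_trace: "integrable (measure_pmf (trace_pmf q x)) (h :: bits \<Rightarrow> real)"
  using finite_set_trace_pmf by (rule integrable_measure_pmf_finite)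

lemma E_Nil: "E [] h = h []"
  by (simp add: trace_pmf_Nil)

lemma E_Cons: "E (a # x) h = (1 - q) * E x (\<lambda>t. h (a # t)) + q * E x h"
  using q0 q1 by (simp add: expectation_trace_pmf_Cons)

text \<open>A retained bit \<open>a\<close> is compared only with the first retained bit of
  \<open>x\<close>; all other pairs lie within the trace of \<open>x\<close>, shifted by one
  position.\<close>

lemma E_stat_Cons:
  "E x (\<lambda>t. stat f i (a # t)) = f i * next_agree a x + E x (stat f (Suc i))"
proof (induction x)
  case (Cons b x)
  have "E x (\<lambda>t. stat f i (a # b # t)) = f i * agree a b + E x (\<lambda>t. stat f (Suc i) (b # t))"
    by (simp add: integrable_trace)
  then show ?case
    unfolding E_Cons Cons next_agree.simps by (simp only: algebra_simps)
qed (simp add: E_Nil)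

text \<open>Input bit \<open>k\<close> is retained with probability \<open>1 - q\<close>, its
  position in the trace is the binomial number of retained bits before it, and the next retained bit
  depends only on the deletions after it. These three are independent, so the mean factorises for
  each \<open>k\<close>.\<close>

lemma E_stat:
  "E x (stat f i) =
    (1 - q) * (\<Sum>k<length x. binomial_mean f k i * next_agree (x ! k) (drop (Suc k) x))"
proof (induction x arbitrary: i)
  case (Cons a x)
  let ?N = "\<lambda>k. next_agree (x ! k) (drop (Suc k) x)"
  let ?F = "\<lambda>i. \<Sum>k<length x. binomial_mean f k i * ?N k"
  have "E (a # x) (stat f i) = (1 - q) * (f i * next_agree a x + (1 - q) * ?F (Suc i) + q * ?F i)"
    unfolding E_Cons E_stat_Cons Cons by (simp only: distrib_left mult_ac add_ac)
  also have "(1 - q) * ?F (Suc i) + q * ?F i = (\<Sum>k<length x. binomial_mean f (Suc k) i * ?N k)"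
    by (simp only: sum_distrib_left binomial_mean.simps distrib_right sum.distrib mult.assoc)
  then have "f i * next_agree a x + (1 - q) * ?F (Suc i) + q * ?F i =
      (\<Sum>k<length (a # x). binomial_mean f k i * next_agree ((a # x) ! k) (drop (Suc k) (a # x)))"
    by (simp only: list.size add_0_right add_Suc_right sum.lessThan_Suc_shift) simp
  finally show ?case .
qed (simp add: E_Nil)

lemma abs_agree_le: "\<bar>agree a b\<bar> \<le> 1"
proof -
  define r where "r = q / (1 + q)"
  have "0 \<le> r" "r \<le> 1" using q0 by (simp_all add: r_def)
  then show ?thesis by (cases "a = b") (simp_all add: agree_def flip: r_def)
qed

lemma agree_refl: "agree a a = 1 / (1 + q)"
  and agree_Not: "agree True False = - (q / (1 + q))" "agree False True = - (q / (1 + q))"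
  using q0 by (simp_all add: agree_def field_simps)

lemma abs_next_agree_le: "\<bar>next_agree a x\<bar> \<le> 1"
proof (induction x)
  case (Cons b x)
  have "\<bar>next_agree a (b # x)\<bar> \<le> (1 - q) * \<bar>agree a b\<bar> + q * \<bar>next_agree a x\<bar>"
    using q0 q1 by (auto intro!: order.trans[OF abs_triangle_ineq] simp: abs_mult)
  also have "\<dots> \<le> (1 - q) * 1 + q * 1"
    using q0 q1 Cons abs_agree_le by (intro add_mono mult_left_mono) auto
  finally show ?case by simp
qed simp

lemma drift_nonneg: "drift x \<ge> 0"
  by (induction x) auto

lemma abs_E_stat_le:
  assumes "\<And>j. \<bar>f j\<bar> \<le> 1"
  shows "\<bar>E x (stat f i)\<bar> \<le> drift x"
proof (induction x arbitrary: i)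
  case (Cons a x)
  have "\<bar>f i * next_agree a x\<bar> \<le> 1 * \<bar>next_agree a x\<bar>"
    unfolding abs_mult using assms by (intro mult_right_mono) auto
  then have "\<bar>E x (\<lambda>t. stat f i (a # t))\<bar> \<le> \<bar>next_agree a x\<bar> + drift x"
    unfolding E_stat_Cons using Cons[of "Suc i"] by linarith
  moreover have "\<bar>E x (stat f i)\<bar> \<le> \<bar>next_agree a x\<bar> + drift x"
    using Cons[of i] by linarith
  ultimately have "(1 - q) * \<bar>E x (\<lambda>t. stat f i (a # t))\<bar> + q * \<bar>E x (stat f i)\<bar> \<le>
      (1 - q) * (\<bar>next_agree a x\<bar> + drift x) + q * (\<bar>next_agree a x\<bar> + drift x)"
    using q0 q1 by (intro add_mono mult_left_mono) auto
  moreover have "\<bar>E (a # x) (stat f i)\<bar> \<le>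
      (1 - q) * \<bar>E x (\<lambda>t. stat f i (a # t))\<bar> + q * \<bar>E x (stat f i)\<bar>"
    unfolding E_Cons using q0 q1
    by (auto intro!: order.trans[OF abs_triangle_ineq] simp: abs_mult)
  ultimately show ?case by (simp add: algebra_simps)
qed (simp add: E_Nil)

lemma abs_stat_le: "\<bar>stat f i t\<bar> \<le> (\<Sum>j = i..<i + length t. \<bar>f j\<bar>)"
proof (induction f i t rule: stat.induct)
  case (1 f i a b t)
  have "\<bar>f i * agree a b\<bar> \<le> \<bar>f i\<bar>"
    unfolding abs_mult using abs_agree_le by (intro mult_left_le) auto
  then have "\<bar>stat f i (a # b # t)\<bar> \<le> \<bar>f i\<bar> + (\<Sum>j = Suc i..<Suc i + length (b # t). \<bar>f j\<bar>)"
    using 1 by simp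
  also have "\<dots> = (\<Sum>j = i..<i + length (a # b # t). \<bar>f j\<bar>)"
    by (subst (2) sum.atLeast_Suc_lessThan) auto
  finally show ?case .
qed (auto intro!: sum_nonneg)

text \<open>Cross terms only involve conditional means of the remaining statistic, which \<open>drift\<close> bounds
  uniformly; hence the second moment is linear, not quadratic, in the total weight.\<close>

lemma E_stat_Cons_sq_le:
  assumes f: "\<And>j. \<bar>f j\<bar> \<le> 1" and d: "drift x + 1 \<le> D"
  shows "E x (\<lambda>t. (stat f i (a # t))\<^sup>2) \<le> (1 + 2 * D) * (\<Sum>j = i..<i + length x. \<bar>f j\<bar>)"
  using d
proof (induction x arbitrary: i a)
  case (Cons b x)
  let ?m = "E x (\<lambda>t. stat f (Suc i) (b # t))"
  let ?\<Phi> = "\<Sum>j = i..<i + length (b # x). \<bar>f j\<bar>"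
  have D: "drift x + 1 \<le> D" using Cons.prems by simp
  \<comment> \<open>The summand 1 in \<open>drift x + 1 \<le> D\<close> pays for the pair formed by
    \<open>b\<close> and the next retained bit.\<close>
  have m: "\<bar>?m\<bar> \<le> D"
  proof -
    have "\<bar>f (Suc i) * next_agree b x\<bar> \<le> 1"
      unfolding abs_mult using f abs_next_agree_le by (intro mult_le_one) auto
    then show ?thesis
      unfolding E_stat_Cons using abs_E_stat_le[of f x "Suc (Suc i)", OF f] D by linarith
  qed
  have w1: "(f i * agree a b)\<^sup>2 \<le> \<bar>f i\<bar>"
  proof -
    have "(f i * agree a b)\<^sup>2 = \<bar>f i\<bar> * (\<bar>f i\<bar> * \<bar>agree a b\<bar>\<^sup>2)"
      by (simp add: power2_eq_square abs_mult)
    also have "\<dots> \<le> \<bar>f i\<bar> * 1"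
      using f[of i] abs_agree_le[of a b] by (intro mult_left_mono mult_le_one power_le_one) auto
    finally show ?thesis by simp
  qed
  have w2: "2 * (f i * agree a b) * ?m \<le> \<bar>f i\<bar> * (2 * D)"
  proof -
    have "2 * (f i * agree a b) * ?m \<le> \<bar>2 * (f i * agree a b) * ?m\<bar>" by simp
    also have "\<dots> = \<bar>f i\<bar> * (2 * (\<bar>agree a b\<bar> * \<bar>?m\<bar>))" by (simp add: abs_mult)
    also have "\<dots> \<le> \<bar>f i\<bar> * (2 * (1 * D))"
      using m abs_agree_le[of a b] by (intro mult_left_mono mult_mono) auto
    finally show ?thesis by simp
  qed
  have "E x (\<lambda>t. (stat f i (a # b # t))\<^sup>2) =
      E x (\<lambda>t. (f i * agree a b)\<^sup>2 + 2 * (f i * agree a b) * stat f (Suc i) (b # t)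
        + (stat f (Suc i) (b # t))\<^sup>2)"
    by (simp add: power2_sum algebra_simps)
  also have "\<dots> = (f i * agree a b)\<^sup>2 + 2 * (f i * agree a b) * ?m
        + E x (\<lambda>t. (stat f (Suc i) (b # t))\<^sup>2)"
    by (simp add: integrable_trace)
  also have "\<dots> \<le> \<bar>f i\<bar> + \<bar>f i\<bar> * (2 * D)
      + (1 + 2 * D) * (\<Sum>j = Suc i..<Suc i + length x. \<bar>f j\<bar>)"
    by (intro add_mono w1 w2 Cons.IH D)
  also have "\<dots> = (1 + 2 * D) * (\<bar>f i\<bar> + (\<Sum>j = Suc i..<Suc i + length x. \<bar>f j\<bar>))"
    by (simp add: algebra_simps)
  also have "\<bar>f i\<bar> + (\<Sum>j = Suc i..<Suc i + length x. \<bar>f j\<bar>) = ?\<Phi>"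
    by (subst (2) sum.atLeast_Suc_lessThan) auto
  finally have keep: "E x (\<lambda>t. (stat f i (a # b # t))\<^sup>2) \<le> (1 + 2 * D) * ?\<Phi>" .
  have "E x (\<lambda>t. (stat f i (a # t))\<^sup>2) \<le> (1 + 2 * D) * (\<Sum>j = i..<i + length x. \<bar>f j\<bar>)"
    by (rule Cons.IH[OF D])
  also have "\<dots> \<le> (1 + 2 * D) * ?\<Phi>"
    using D drift_nonneg[of x] by (intro mult_left_mono) auto
  finally have "(1 - q) * E x (\<lambda>t. (stat f i (a # b # t))\<^sup>2) + q * E x (\<lambda>t. (stat f i (a # t))\<^sup>2)
      \<le> (1 - q) * ((1 + 2 * D) * ?\<Phi>) + q * ((1 + 2 * D) * ?\<Phi>)"
    using keep q0 q1 by (intro add_mono mult_left_mono) auto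
  then show ?case by (simp only: E_Cons) (simp add: algebra_simps)
qed (simp add: E_Nil)

lemma E_stat_sq_le:
  assumes f: "\<And>j. \<bar>f j\<bar> \<le> 1" and d: "drift x + 1 \<le> D"
  shows "E x (\<lambda>t. (stat f i t)\<^sup>2) \<le> (1 + 2 * D) * (\<Sum>j = i..<i + length x. \<bar>f j\<bar>)"
  using d
proof (induction x)
  case (Cons b x)
  let ?\<Phi> = "\<Sum>j = i..<i + length (b # x). \<bar>f j\<bar>"
  have D: "drift x + 1 \<le> D" using Cons.prems by simp
  have mono: "(1 + 2 * D) * (\<Sum>j = i..<i + length x. \<bar>f j\<bar>) \<le> (1 + 2 * D) * ?\<Phi>"
    using D drift_nonneg[of x] by (intro mult_left_mono) auto
  have "(1 - q) * E x (\<lambda>t. (stat f i (b # t))\<^sup>2) + q * E x (\<lambda>t. (stat f i t)\<^sup>2)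
      \<le> (1 - q) * ((1 + 2 * D) * ?\<Phi>) + q * ((1 + 2 * D) * ?\<Phi>)"
    using order.trans[OF Cons.IH[OF D] mono] order.trans[OF E_stat_Cons_sq_le[OF f D] mono] q0 q1
    by (intro add_mono mult_left_mono) auto
  then show ?case by (simp only: E_Cons) (simp add: algebra_simps)
qed (simp add: E_Nil)

section \<open>Alternating runs and the exact effect of the defect on the mean\<close>

abbreviation alternating :: "nat \<Rightarrow> bits" where
  "alternating m \<equiv> string_power [False, True] m"

lemma alternating_0: "alternating 0 = []"
  and alternating_Suc: "alternating (Suc m) = False # True # alternating m"
  by (simp_all add: string_power_def)

lemma nth_alternating: "k < 2 * m \<Longrightarrow> alternating m ! k = odd k"
proof (induction m arbitrary: k)
  case (Suc m)
  then show ?case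
    by (cases k; cases "k - 1") (auto simp: alternating_Suc)
qed simp

text \<open>The centring of \<open>agree\<close> makes each pair 01 after a 1 contribute zero, so
  only the deletion of the whole run, of probability \<open>q ^ (2 * m)\<close>, lets
  \<open>z\<close> matter.\<close>

lemma next_agree_True_alternating:
  "next_agree True (alternating m @ z) = q ^ (2 * m) * next_agree True z"
proof (induction m)
  case (Suc m)
  have "(1 - q) * agree True False + q * ((1 - q) * agree True True) = 0"
    using q0 by (simp add: agree_def field_simps)
  then show ?case
    using Suc by (simp add: alternating_Suc algebra_simps)
qed (simp add: alternating_0)

text \<open>A 0 in front of 01 breaks the alternation, so the pairs no longer cancel. Each
  contributes \<open>(1 - q) * (1 - q\<^sup>2) / (1 + q)\<close>, discounted by
  \<open>q\<^sup>2\<close> per preceding pair, and the geometric sum is the first term.\<close>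

lemma next_agree_False_alternating:
  "next_agree False (alternating m @ z) =
    (1 - q) * (1 - q ^ (2 * m)) / (1 + q) + q ^ (2 * m) * next_agree False z"
proof (induction m)
  case (Suc m)
  have "(1 - q) * agree False False + q * ((1 - q) * agree False True) = (1 - q) * (1 - q\<^sup>2) / (1 + q)"
    by (simp add: agree_refl agree_Not divide_inverse algebra_simps power2_eq_square)
  moreover have "(1 - q) * (1 - q\<^sup>2) / (1 + q) + q\<^sup>2 * ((1 - q) * (1 - q ^ (2 * m)) / (1 + q)) =
      (1 - q) * (1 - q ^ (2 * Suc m)) / (1 + q)"
    by (simp add: divide_inverse algebra_simps power2_eq_square)
  ultimately show ?case
    using Suc by (simp add: alternating_Suc algebra_simps power2_eq_square)
qed (simp add: alternating_0)

text \<open>Inside the run the centring cancels except when the rest of the run is deleted. A pair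
  01 followed by \<open>j\<close> further pairs of the run therefore costs at most
  \<open>3 * q ^ (2 * j)\<close>: 2 for its 0 and 1 for its 1. The sum is bounded independently of
  \<open>m\<close>.\<close>

lemma drift_alternating_le: "drift (alternating m @ z) \<le> 3 / (1 - q) + drift z"
proof -
  have "drift (alternating m @ z) \<le> 3 * (\<Sum>j<m. (q\<^sup>2) ^ j) + drift z"
  proof (induction m)
    case (Suc m)
    have T: "\<bar>next_agree True (alternating m @ z)\<bar> \<le> q ^ (2 * m)"
      using q0 abs_next_agree_le[of True z]
      by (simp add: next_agree_True_alternating abs_mult mult_left_le)
    have "next_agree False (True # alternating m @ z) =
        q ^ (2 * m) * (q * next_agree False z - (1 - q) * (q / (1 + q)))"
      by (simp add: next_agree_False_alternating agree_Not divide_inverse algebra_simps)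
    also have "\<bar>\<dots>\<bar> \<le> q ^ (2 * m) * 2"
      unfolding abs_mult
    proof (rule mult_mono)
      have "\<bar>q * next_agree False z\<bar> \<le> 1"
        unfolding abs_mult using q0 q1 abs_next_agree_le by (intro mult_le_one) auto
      moreover have "\<bar>(1 - q) * (q / (1 + q))\<bar> \<le> 1"
        unfolding abs_mult using q0 q1 by (intro mult_le_one) auto
      ultimately show "\<bar>q * next_agree False z - (1 - q) * (q / (1 + q))\<bar> \<le> 2" by linarith
    qed (use q0 in auto)
    finally show ?case using T Suc by (simp add: alternating_Suc flip: power_mult)
  qed (simp add: alternating_0)
  also have "(\<Sum>j<m. (q\<^sup>2) ^ j) \<le> 1 / (1 - q)"
  proof -
    have q2: "q\<^sup>2 \<le> q" using q0 q1 by (simp add: power2_eq_square mult_left_le)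
    have "(\<Sum>j<m. (q\<^sup>2) ^ j) = (1 - (q\<^sup>2) ^ m) / (1 - q\<^sup>2)"
      using q2 q1 by (simp add: sum_gp_strict)
    also have "\<dots> \<le> 1 / (1 - q)" using q0 q1 q2 by (intro frac_le) auto
    finally show ?thesis .
  qed
  finally show ?thesis by simp
qed

text \<open>The continuation after \<open>w\<close> is seen only if all of \<open>w\<close> is
  deleted.\<close>

lemma next_agree_append_diff:
  "next_agree a (w @ z1) - next_agree a (w @ z2) =
    q ^ length w * (next_agree a z1 - next_agree a z2)"
proof (induction w)
  case (Cons b w)
  have "next_agree a ((b # w) @ z1) - next_agree a ((b # w) @ z2) =
      q * (next_agree a (w @ z1) - next_agree a (w @ z2))"
    by (simp add: algebra_simps)
  then show ?case by (simp add: Cons)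
qed simp

text \<open>The difference is summed over input positions. A bit of the front flank with
  \<open>e\<close> flank bits after it sees the block only if those are deleted, and its value
  alternates with \<open>e\<close>; this gives the factor \<open>(- q) ^ e\<close>. The block itself
  gives four terms, and in the back flank the two strings agree.\<close>

lemma E_stat_diff:
  fixes f :: "nat \<Rightarrow> real" and m :: nat
  defines "s \<equiv> 2 * m" and "F \<equiv> \<lambda>k. binomial_mean f k 0"
  shows "E (alternating m @ [True, False, False, True] @ alternating m) (stat f 0)
      - E (alternating m @ [False, True, True, False] @ alternating m) (stat f 0) =
    (1 - q) * ((1 - q) ^ 3 * (1 + q) * (\<Sum>e<s. (- q) ^ e * F (s - Suc e))
      - (1 - q) * (1 - q ^ s) / (1 + q)
        * (q ^ 3 * F s - q\<^sup>2 * F (s + 1) - q * F (s + 2) + F (s + 3)))"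
proof -
  let ?v = "alternating m"
  define zx where "zx = [True, False, False, True] @ ?v"
  define zy where "zy = [False, True, True, False] @ ?v"
  define d where "d k = next_agree ((?v @ zx) ! k) (drop (Suc k) (?v @ zx))
      - next_agree ((?v @ zy) ! k) (drop (Suc k) (?v @ zy))" for k
  have len: "length ?v = s" by (simp add: length_string_power s_def)
  have vT: "next_agree True ?v = 0"
    using next_agree_True_alternating[of m "[]"] by simp
  have vF: "next_agree False ?v = (1 - q) * (1 - q ^ s) / (1 + q)"
    using next_agree_False_alternating[of m "[]"] by (simp add: s_def)
  have d_front: "d (s - Suc e) = (1 - q) ^ 3 * (1 + q) * (- q) ^ e" if e: "e < s" for e
  proof -
    define k where "k = s - Suc e"
    have k: "k < s" "s - Suc k = e" using e by (auto simp: k_def)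
    have nth: "?v ! k = even e"
      using k e by (subst nth_alternating) (auto simp: s_def k_def even_Suc_div_two)
    have "d k = q ^ e * (next_agree (even e) zx - next_agree (even e) zy)"
      using k by (simp add: d_def nth_append len nth next_agree_append_diff)
    also have "next_agree (even e) zx - next_agree (even e) zy =
        (if even e then 1 else - 1) * ((1 - q) ^ 3 * (1 + q))"
      by (simp add: zx_def zy_def agree_def)
        (simp add: algebra_simps power2_eq_square power3_eq_cube)
    finally show ?thesis by (simp add: k_def)
  qed
  \<comment> \<open>As the blocks are complementary, agreements inside the block cancel. What
    remains is the passage into the back flank, where \<open>next_agree True ?v\<close>
    vanishes.\<close>
  have d_back: "d (s + 0) = - (q ^ 3) * next_agree False ?v"
    "d (s + 1) = q\<^sup>2 * next_agree False ?v"
    "d (s + 2) = q * next_agree False ?v"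
    "d (s + 3) = - next_agree False ?v"
    by (simp_all add: d_def zx_def zy_def nth_append len vT agree_refl agree_Not divide_inverse
        algebra_simps power2_eq_square power3_eq_cube)
  have d_tail: "d (s + (4 + j)) = 0" for j
    by (simp add: d_def zx_def zy_def nth_append len numeral_eq_Suc)
  have "(\<Sum>k<s + N. F k * d k) = (\<Sum>k<s. F k * d k) + (\<Sum>j<N. F (s + j) * d (s + j))" for N
    by (induction N) simp_all
  then have "(\<Sum>k<s + (4 + s). F k * d k) = (\<Sum>k<s. F k * d k) + (\<Sum>j<4 + s. F (s + j) * d (s + j))" .
  also have "(\<Sum>k<s. F k * d k) = (\<Sum>e<s. F (s - Suc e) * d (s - Suc e))"
    by (rule sum.nat_diff_reindex[symmetric])
  also have "\<dots> = (1 - q) ^ 3 * (1 + q) * (\<Sum>e<s. (- q) ^ e * F (s - Suc e))"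
    by (simp add: d_front sum_distrib_left mult_ac)
  also have "(\<Sum>j<4 + s. F (s + j) * d (s + j)) = (\<Sum>j<4. F (s + j) * d (s + j))"
  proof (rule sum.mono_neutral_right)
    show "\<forall>j\<in>{..<4 + s} - {..<4}. F (s + j) * d (s + j) = 0"
    proof
      fix j assume "j \<in> {..<4 + s} - {..<4}"
      then show "F (s + j) * d (s + j) = 0" using d_tail[of "j - 4"] by simp
    qed
  qed auto
  also have "\<dots> = - next_agree False ?v
      * (q ^ 3 * F s - q\<^sup>2 * F (s + 1) - q * F (s + 2) + F (s + 3))"
    using d_back by (simp add: eval_nat_numeral algebra_simps)
  finally have *: "(\<Sum>k<s + (4 + s). F k * d k) = (1 - q) ^ 3 * (1 + q) * (\<Sum>e<s. (- q) ^ e * F (s - Suc e))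
      - (1 - q) * (1 - q ^ s) / (1 + q)
        * (q ^ 3 * F s - q\<^sup>2 * F (s + 1) - q * F (s + 2) + F (s + 3))"
    by (simp add: vF)
  have lens: "length (?v @ zx) = s + (4 + s)" "length (?v @ zy) = s + (4 + s)"
    by (simp_all add: zx_def zy_def len)
  have "E (?v @ zx) (stat f 0) - E (?v @ zy) (stat f 0) = (1 - q) * (\<Sum>k<s + (4 + s). F k * d k)"
    unfolding E_stat lens F_def d_def
    by (simp only: right_diff_distrib sum_subtractf)
  then show ?thesis unfolding * by (simp add: zx_def zy_def)
qed

subsection \<open>Difference of the means\<close>

lemma binomial_mean_Suc_arg: "binomial_mean f k (Suc i) = binomial_mean (\<lambda>j. f (Suc j)) k i"
  by (induction k arbitrary: i) simp_all

lemma binomial_mean_linear: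
  "binomial_mean (\<lambda>j. a * (f j - g j) - b) k i = a * (binomial_mean f k i - binomial_mean g k i) - b"
proof (induction k arbitrary: i)
  case (Suc k)
  show ?case unfolding binomial_mean.simps Suc by (simp add: algebra_simps)
qed simp

lemma binomial_mean_cmult: "binomial_mean (\<lambda>j. a * f j) k i = a * binomial_mean f k i"
  by (induction k arbitrary: i) (simp_all add: algebra_simps)

lemma abs_binomial_mean_le:
  assumes "\<And>j. \<bar>f j\<bar> \<le> g j"
  shows "\<bar>binomial_mean f k i\<bar> \<le> binomial_mean g k i"
proof (induction k arbitrary: i)
  case (Suc k)
  have "\<bar>binomial_mean f (Suc k) i\<bar> \<le>
      (1 - q) * \<bar>binomial_mean f k (Suc i)\<bar> + q * \<bar>binomial_mean f k i\<bar>"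
    using q0 q1 by (auto intro!: order.trans[OF abs_triangle_ineq] simp: abs_mult)
  also have "\<dots> \<le> binomial_mean g (Suc k) i"
    using q0 q1 Suc by (auto intro!: add_mono mult_left_mono)
  finally show ?case .
qed (use assms in simp)

text \<open>Variance of the binomial distribution plus squared bias.\<close>

lemma binomial_mean_square:
  "binomial_mean (\<lambda>j. (real j - c)\<^sup>2) k i = real k * (1 - q) * q + (real i + real k * (1 - q) - c)\<^sup>2"
proof (induction k arbitrary: i)
  case (Suc k)
  show ?case
    unfolding binomial_mean.simps Suc by (simp add: power2_eq_square) (simp add: algebra_simps)
qed simp

text \<open>One more input bit moves the position by one with probability \<open>1 - q\<close>, so
  the increment of the mean is \<open>1 - q\<close> times the mean of the increments of
  \<open>f\<close>. The slope error then averages to a second moment around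
  \<open>s * (1 - q)\<close>, which is of order \<open>s\<close> near \<open>k = s\<close>.\<close>

lemma binomial_mean_step:
  assumes A: "A > 0" and s: "s \<ge> 1" and k: "k \<le> s + 3"
    and step: "\<And>j. \<bar>A * (f j - f (Suc j)) - 1\<bar> \<le> 12 * (real j - real s * (1 - q))\<^sup>2 / A\<^sup>2"
  shows "\<bar>binomial_mean f k 0 - binomial_mean f (Suc k) 0 - (1 - q) / A\<bar> \<le>
    (1 - q) / A * (12 * real s / A\<^sup>2) * (1 + (real k - real s)\<^sup>2)"
proof -
  let ?c = "real s * (1 - q)"
  let ?G = "binomial_mean (\<lambda>j. A * (f j - f (Suc j)) - 1) k 0"
  have "\<bar>?G\<bar> \<le> binomial_mean (\<lambda>j. 12 / A\<^sup>2 * (real j - ?c)\<^sup>2) k 0"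
    using step by (intro abs_binomial_mean_le) simp
  also have "\<dots> = 12 / A\<^sup>2 * (real k * ((1 - q) * q) + ((real k - real s) * (1 - q))\<^sup>2)"
    unfolding binomial_mean_cmult binomial_mean_square by (simp add: algebra_simps)
  also have "\<dots> \<le> 12 / A\<^sup>2 * (real s + real s * (real k - real s)\<^sup>2)"
  proof (intro mult_left_mono add_mono)
    have "0 \<le> (1 / 2 - q)\<^sup>2" by simp
    then have "(1 - q) * q \<le> 1 / 4" by (simp add: power2_eq_square algebra_simps)
    then have "real k * ((1 - q) * q) \<le> real k * (1 / 4)" by (intro mult_left_mono) auto
    \<comment> \<open>Here \<open>k / 4 \<le> (s + 3) / 4 \<le> s\<close>, as
      \<open>s \<ge> 1\<close>.\<close>
    also have "\<dots> \<le> real s" using k s by simp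
    finally show "real k * ((1 - q) * q) \<le> real s" .
    have "((real k - real s) * (1 - q))\<^sup>2 \<le> (real k - real s)\<^sup>2 * 1"
      unfolding power_mult_distrib using q0 q1 by (intro mult_left_mono power_le_one) auto
    also have "\<dots> \<le> real s * (real k - real s)\<^sup>2"
      using s mult_right_mono[of 1 "real s" "(real k - real s)\<^sup>2"] by simp
    finally show "((real k - real s) * (1 - q))\<^sup>2 \<le> real s * (real k - real s)\<^sup>2" .
  qed simp
  also have "\<dots> = 12 * real s / A\<^sup>2 * (1 + (real k - real s)\<^sup>2)"
    by (simp add: divide_inverse algebra_simps)
  finally have G: "\<bar>?G\<bar> \<le> 12 * real s / A\<^sup>2 * (1 + (real k - real s)\<^sup>2)" .
  have "binomial_mean f k 0 - binomial_mean f (Suc k) 0 - (1 - q) / A = (1 - q) / A * ?G"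
    unfolding binomial_mean_linear binomial_mean.simps binomial_mean_Suc_arg
    using A by (simp add: field_simps)
  then have "\<bar>binomial_mean f k 0 - binomial_mean f (Suc k) 0 - (1 - q) / A\<bar> = (1 - q) / A * \<bar>?G\<bar>"
    using A q1 by (simp add: abs_mult)
  also have "\<dots> \<le> (1 - q) / A * (12 * real s / A\<^sup>2 * (1 + (real k - real s)\<^sup>2))"
    using G A q1 by (intro mult_left_mono) auto
  finally show ?thesis by (simp add: mult.assoc)
qed

text \<open>The cubic factor is the growth of the tangent-line error at distance
  \<open>Suc e\<close> from \<open>s\<close>. It is absorbed by replacing \<open>q\<close> with the
  larger ratio \<open>(1 + q) / 2\<close>, still below 1.\<close>

lemma summable_cubic: "summable (\<lambda>e. q ^ e * (real (Suc e) * (1 + (real (Suc e))\<^sup>2)))"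
proof (rule summable_comparison_test_bigo)
  show "summable (\<lambda>e. norm (((1 + q) / 2) ^ e))"
    using q0 q1 by (simp add: summable_geometric)
  have "q / ((1 + q) / 2) < 1" using q0 q1 by simp
  then show "(\<lambda>e. q ^ e * (real (Suc e) * (1 + (real (Suc e))\<^sup>2))) \<in> O(\<lambda>e. ((1 + q) / 2) ^ e)"
    using q0 q1 by real_asymp
qed

text \<open>The constant term of \<open>F\<close> cancels exactly in \<open>E_stat_diff\<close>, so what matters is the deviation
  of \<open>F\<close> from its tangent line at \<open>s\<close>.\<close>

lemma linear_approximation:
  fixes F :: "nat \<Rightarrow> real" and L r :: real and s :: nat
  defines "R \<equiv> \<lambda>k. F k - F s + L * (real k - real s)"
  assumes L: "L \<ge> 0" and r: "r \<ge> 0"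
    and step: "\<And>k. k \<le> s + 3 \<Longrightarrow> \<bar>F k - F (Suc k) - L\<bar> \<le> L * r * (1 + (real k - real s)\<^sup>2)"
  shows "e \<le> s \<Longrightarrow> \<bar>R (s - e)\<bar> \<le> L * r * (real e * (1 + (real e)\<^sup>2))"
    and "i \<le> 3 \<Longrightarrow> \<bar>R (s + i)\<bar> \<le> L * r * (real i * (1 + (real i)\<^sup>2))"
proof -
  have Lr: "0 \<le> L * r" using L r by simp
  \<comment> \<open>Since \<open>R s = 0\<close>, the deviation is a sum of step errors proportional
    to \<open>1 + t\<^sup>2\<close>; the cubic grows at least as fast as these accumulate, in both
    directions.\<close>
  have grow: "real j * (1 + (real j)\<^sup>2) + (1 + t\<^sup>2) \<le> real (Suc j) * (1 + (real (Suc j))\<^sup>2)"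
    if "\<bar>t\<bar> \<le> real (Suc j)" for j t
  proof -
    have "t\<^sup>2 \<le> (real (Suc j))\<^sup>2"
      using that by (metis abs_le_square_iff abs_of_nat)
    moreover have "(real j)\<^sup>2 \<le> (real (Suc j))\<^sup>2" by (intro power_mono) auto
    ultimately have "real j * (1 + (real j)\<^sup>2) + (1 + t\<^sup>2) \<le>
        real j * (1 + (real (Suc j))\<^sup>2) + (1 + (real (Suc j))\<^sup>2)"
      by (intro add_mono mult_left_mono) auto
    then show ?thesis by (simp add: algebra_simps)
  qed
  have RS: "R k - R (Suc k) = F k - F (Suc k) - L" for k
    by (simp add: R_def algebra_simps)
  show "\<bar>R (s - e)\<bar> \<le> L * r * (real e * (1 + (real e)\<^sup>2))" if "e \<le> s" for e
    using that
  proof (induction e)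
    case (Suc e)
    have k: "Suc (s - Suc e) = s - e" "real (s - Suc e) - real s = - real (Suc e)"
      using Suc.prems by auto
    have "\<bar>R (s - Suc e)\<bar> \<le> \<bar>R (s - e)\<bar> + \<bar>R (s - Suc e) - R (s - e)\<bar>" by linarith
    also have "\<dots> \<le> L * r * (real e * (1 + (real e)\<^sup>2)) + L * r * (1 + (- real (Suc e))\<^sup>2)"
      using Suc step[of "s - Suc e"] RS[of "s - Suc e"] unfolding k by (intro add_mono) auto
    also have "\<dots> \<le> L * r * (real (Suc e) * (1 + (real (Suc e))\<^sup>2))"
      unfolding distrib_left[symmetric] using Lr by (intro mult_left_mono grow) auto
    finally show ?case .
  qed (simp add: R_def)
  show "\<bar>R (s + i)\<bar> \<le> L * r * (real i * (1 + (real i)\<^sup>2))" if "i \<le> 3" for i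
    using that
  proof (induction i)
    case (Suc i)
    have k: "real (s + i) - real s = real i" by simp
    have "\<bar>R (s + Suc i)\<bar> \<le> \<bar>R (s + i)\<bar> + \<bar>R (s + i) - R (Suc (s + i))\<bar>" by simp
    also have "\<dots> \<le> L * r * (real i * (1 + (real i)\<^sup>2)) + L * r * (1 + (real i)\<^sup>2)"
      using Suc step[of "s + i"] RS[of "s + i"] unfolding k by (intro add_mono) auto
    also have "\<dots> \<le> L * r * (real (Suc i) * (1 + (real (Suc i))\<^sup>2))"
      unfolding distrib_left[symmetric] using Lr by (intro mult_left_mono grow) auto
    finally show ?case .
  qed (simp add: R_def)
qed

lemma sum_neg_powers: "even s \<Longrightarrow> (\<Sum>e<s. (- q) ^ e) = (1 - q ^ s) / (1 + q)"
  using q0 by (simp add: sum_gp_strict)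

text \<open>By the closed form, \<open>(1 + q)\<^sup>2\<close> times the sum tends to 1. For large
  \<open>m\<close> the linear part of \<open>F\<close> on the front flank thus cannot work against
  the contribution of the block.\<close>

lemma eventually_alternating_moment_nonneg:
  "eventually (\<lambda>m. (\<Sum>e<2 * m. (- q) ^ e * real (Suc e)) \<ge> 0) sequentially"
proof -
  have closed: "(1 + q)\<^sup>2 * (\<Sum>e<2 * m. (- q) ^ e * real (Suc e)) =
      1 - (2 * real m + 1) * q ^ (2 * m) - 2 * real m * q ^ (2 * m + 1)" for m
    by (induction m) (simp_all add: algebra_simps power2_eq_square)
  have "(\<lambda>m. (2 * real m + 1) * q ^ (2 * m) + 2 * real m * q ^ (2 * m + 1)) \<longlonglongrightarrow> 0"
    using q0 q1 by real_asymp
  then have "eventually (\<lambda>m. (2 * real m + 1) * q ^ (2 * m) + 2 * real m * q ^ (2 * m + 1) < 1) sequentially"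
    by (rule order_tendstoD) simp
  then show ?thesis
  proof eventually_elim
    case (elim m)
    then have "0 \<le> (1 + q)\<^sup>2 * (\<Sum>e<2 * m. (- q) ^ e * real (Suc e))"
      unfolding closed by simp
    then show ?case using q0 by (simp add: zero_le_mult_iff)
  qed
qed

text \<open>Insert \<open>F k = F s - L * (k - s) + R k\<close> with slope
  \<open>L = (1 - q) / A\<close>. The constant part cancels; the linear part is nonnegative on the
  front flank and at least \<open>3 * L * (1 - q) ^ 3\<close> on the block. The remainders cost at
  most \<open>L * r * (Z + 42)\<close>, which the lower bound on \<open>A\<close> limits to
  \<open>L * (1 - q) ^ 3\<close>.\<close>

lemma E_stat_diff_ge:
  fixes f :: "nat \<Rightarrow> real" and m :: nat and A :: real
  defines "s \<equiv> 2 * m"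
  defines "Z \<equiv> \<Sum>e. q ^ e * (real (Suc e) * (1 + (real (Suc e))\<^sup>2))"
  assumes A: "A > 0" and m: "m \<ge> 1"
    and moment: "(\<Sum>e<2 * m. (- q) ^ e * real (Suc e)) \<ge> 0"
    and A2: "12 * real s / A\<^sup>2 \<le> (1 - q) ^ 3 / (Z + 42)"
    and step: "\<And>j. \<bar>A * (f j - f (Suc j)) - 1\<bar> \<le> 12 * (real j - real s * (1 - q))\<^sup>2 / A\<^sup>2"
  shows "E (alternating m @ [True, False, False, True] @ alternating m) (stat f 0)
      - E (alternating m @ [False, True, True, False] @ alternating m) (stat f 0)
      \<ge> 2 * (1 - q) ^ 5 / A"
proof -
  define F where "F k = binomial_mean f k 0" for k
  define L where "L = (1 - q) / A"
  define r where "r = 12 * real s / A\<^sup>2"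
  define R where "R k = F k - F s + L * (real k - real s)" for k
  define \<kappa> where "\<kappa> = (1 - q) ^ 3 * (1 + q)"
  define \<tau> where "\<tau> = (1 - q) * (1 - q ^ s) / (1 + q)"
  have L: "L > 0" and r: "r \<ge> 0" using A q1 by (simp_all add: L_def r_def)
  have Lr: "L * r \<ge> 0" using L r by simp
  have s: "s \<ge> 2" "even s" using m by (auto simp: s_def)
  have Z: "Z \<ge> 0" unfolding Z_def using q0 by (intro suminf_nonneg summable_cubic) auto
  have Fstep: "\<bar>F k - F (Suc k) - L\<bar> \<le> L * r * (1 + (real k - real s)\<^sup>2)" if "k \<le> s + 3" for k
    unfolding F_def L_def r_def using A s that step by (intro binomial_mean_step) auto
  note R = linear_approximation[of L r s F, OF less_imp_le[OF L] r Fstep, folded R_def]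
  have qs: "q ^ s \<le> q\<^sup>2" using s q0 q1 by (intro power_decreasing) auto
  have q2: "1 - q\<^sup>2 = (1 - q) * (1 + q)" by (simp add: power2_eq_square algebra_simps)
  have \<tau>: "(1 - q)\<^sup>2 \<le> \<tau>" "\<tau> \<le> 1"
  proof -
    have "(1 - q)\<^sup>2 = (1 - q) * (1 - q\<^sup>2) / (1 + q)"
      unfolding q2 using q0 by (simp add: power2_eq_square)
    also have "\<dots> \<le> \<tau>" unfolding \<tau>_def using qs q0 q1
      by (intro divide_right_mono mult_left_mono) auto
    finally show "(1 - q)\<^sup>2 \<le> \<tau>" .
    have "(1 - q) * (1 - q ^ s) \<le> 1 * 1" using q0 q1 by (intro mult_mono) (auto simp: power_le_one)
    also have "\<dots> \<le> 1 + q" using q0 by simp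
    finally show "\<tau> \<le> 1" unfolding \<tau>_def using q0 by simp
  qed
  have \<tau>0: "0 \<le> \<tau>" using \<tau>(1) by (meson order.trans zero_le_power2)
  have \<kappa>: "0 \<le> \<kappa>" "\<kappa> \<le> 1"
  proof -
    have "\<kappa> = (1 - q)\<^sup>2 * (1 - q\<^sup>2)"
      unfolding \<kappa>_def q2 by (simp add: power2_eq_square power3_eq_cube)
    also have "\<dots> \<le> 1 * 1" using q0 q1 by (intro mult_mono power_le_one) (auto simp: power_le_one)
    finally show "\<kappa> \<le> 1" by simp
  qed (use q0 q1 in \<open>simp add: \<kappa>_def\<close>)
  have F_eq: "F k = F s - L * (real k - real s) + R k" for k by (simp add: R_def)
  have F_front: "F (s - Suc e) = F s + L * real (Suc e) + R (s - Suc e)" if "e < s" for e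
    unfolding F_eq[of "s - Suc e"] using that by (simp add: algebra_simps of_nat_diff)
  have F_back: "F (s + i) = F s - L * real i + R (s + i)" for i
    unfolding F_eq[of "s + i"] by simp
  define \<mu> where "\<mu> = (\<Sum>e<s. (- q) ^ e * real (Suc e))"
  define \<rho> where "\<rho> = (\<Sum>e<s. (- q) ^ e * R (s - Suc e))"
  define \<sigma> where "\<sigma> = R (s + 3) - q\<^sup>2 * R (s + 1) - q * R (s + 2)"
  have front: "(\<Sum>e<s. (- q) ^ e * F (s - Suc e)) = F s * ((1 - q ^ s) / (1 + q)) + L * \<mu> + \<rho>"
  proof -
    have "(\<Sum>e<s. (- q) ^ e * F (s - Suc e)) =
        (\<Sum>e<s. F s * (- q) ^ e + L * ((- q) ^ e * real (Suc e)) + (- q) ^ e * R (s - Suc e))"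
      by (intro sum.cong refl) (simp add: F_front algebra_simps)
    also have "\<dots> = F s * (\<Sum>e<s. (- q) ^ e) + L * \<mu> + \<rho>"
      by (simp only: sum.distrib sum_distrib_left \<mu>_def \<rho>_def)
    finally show ?thesis by (simp only: sum_neg_powers[OF s(2)])
  qed
  \<comment> \<open>Matches the constant part of the block through
    \<open>q ^ 3 - q\<^sup>2 - q + 1 = (1 - q)\<^sup>2 * (1 + q)\<close>.\<close>
  have cancel: "\<kappa> * (F s * ((1 - q ^ s) / (1 + q))) = \<tau> * (F s * ((1 - q)\<^sup>2 * (1 + q)))"
    by (simp add: \<kappa>_def \<tau>_def power2_eq_square power3_eq_cube)
  have "\<kappa> * (\<Sum>e<s. (- q) ^ e * F (s - Suc e))
      - \<tau> * (q ^ 3 * F s - q\<^sup>2 * F (s + 1) - q * F (s + 2) + F (s + 3))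
      = \<kappa> * (L * \<mu>) + \<kappa> * \<rho> + \<tau> * (L * ((1 - q) * (3 + q))) - \<tau> * \<sigma>"
    unfolding front F_back distrib_left cancel \<sigma>_def
    by (simp add: algebra_simps power2_eq_square power3_eq_cube)
  moreover have "\<kappa> * (L * \<mu>) \<ge> 0"
    using \<kappa> L moment by (simp add: \<mu>_def s_def)
  moreover have "\<kappa> * \<rho> \<ge> - (L * r * Z)"
  proof -
    have "\<bar>\<rho>\<bar> \<le> (\<Sum>e<s. \<bar>(- q) ^ e * R (s - Suc e)\<bar>)" unfolding \<rho>_def by (rule sum_abs)
    also have "\<dots> \<le> (\<Sum>e<s. q ^ e * (L * r * (real (Suc e) * (1 + (real (Suc e))\<^sup>2))))"
    proof (rule sum_mono)
      fix e assume "e \<in> {..<s}"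
      then have "\<bar>R (s - Suc e)\<bar> \<le> L * r * (real (Suc e) * (1 + (real (Suc e))\<^sup>2))"
        by (intro R(1)) auto
      then show "\<bar>(- q) ^ e * R (s - Suc e)\<bar> \<le>
          q ^ e * (L * r * (real (Suc e) * (1 + (real (Suc e))\<^sup>2)))"
        unfolding abs_mult power_abs abs_minus_cancel using q0 by (intro mult_mono) auto
    qed
    also have "\<dots> = L * r * (\<Sum>e<s. q ^ e * (real (Suc e) * (1 + (real (Suc e))\<^sup>2)))"
      by (simp only: sum_distrib_left mult_ac)
    also have "\<dots> \<le> L * r * Z"
      unfolding Z_def using Lr q0 by (intro mult_left_mono sum_le_suminf summable_cubic) auto
    finally have "\<bar>\<rho>\<bar> \<le> L * r * Z" .
    moreover have "\<bar>\<kappa> * \<rho>\<bar> \<le> \<bar>\<rho>\<bar>" unfolding abs_mult using \<kappa> by (simp add: mult_left_le_one_le)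
    ultimately show ?thesis by linarith
  qed
  moreover have "\<tau> * (L * ((1 - q) * (3 + q))) \<ge> 3 * L * (1 - q) ^ 3"
  proof -
    have "3 * L * (1 - q) ^ 3 = (1 - q)\<^sup>2 * (L * ((1 - q) * 3))"
      by (simp add: power2_eq_square power3_eq_cube)
    also have "\<dots> \<le> \<tau> * (L * ((1 - q) * (3 + q)))"
      using \<tau> \<tau>0 L q0 q1 by (intro mult_mono mult_left_mono) auto
    finally show ?thesis .
  qed
  \<comment> \<open>The cubic \<open>i * (1 + i\<^sup>2)\<close> takes the values 2, 10 and 30 at
    \<open>i = 1, 2, 3\<close>, with sum 42.\<close>
  moreover have "\<tau> * \<sigma> \<le> L * r * 42"
  proof -
    have "\<bar>q\<^sup>2 * R (s + 1)\<bar> \<le> \<bar>R (s + 1)\<bar>" "\<bar>q * R (s + 2)\<bar> \<le> \<bar>R (s + 2)\<bar>"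
      unfolding abs_mult using q0 q1 by (auto intro!: mult_left_le_one_le simp: power_le_one)
    then have "\<bar>\<sigma>\<bar> \<le> L * r * 42"
      using R(2)[of 1] R(2)[of 2] R(2)[of 3] unfolding \<sigma>_def by (simp add: algebra_simps)
    moreover have "\<bar>\<tau> * \<sigma>\<bar> \<le> \<bar>\<sigma>\<bar>" unfolding abs_mult using \<tau> \<tau>0 by (simp add: mult_left_le_one_le)
    ultimately show ?thesis by linarith
  qed
  moreover have "L * r * (Z + 42) \<le> L * (1 - q) ^ 3"
  proof -
    have "r * (Z + 42) \<le> (1 - q) ^ 3" using A2 Z by (simp add: r_def pos_le_divide_eq)
    then show ?thesis using L by (simp add: mult.assoc)
  qed
  ultimately have "\<kappa> * (\<Sum>e<s. (- q) ^ e * F (s - Suc e))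
      - \<tau> * (q ^ 3 * F s - q\<^sup>2 * F (s + 1) - q * F (s + 2) + F (s + 3)) \<ge> 2 * L * (1 - q) ^ 3"
    by (simp add: algebra_simps)
  then have "(1 - q) * (2 * L * (1 - q) ^ 3) \<le> E (alternating m @ [True, False, False, True] @ alternating m) (stat f 0)
      - E (alternating m @ [False, True, True, False] @ alternating m) (stat f 0)"
    unfolding E_stat_diff s_def[symmetric] F_def[symmetric] \<kappa>_def[symmetric] \<tau>_def[symmetric]
    using q1 by (intro mult_left_mono) auto
  moreover have "(1 - q) * (2 * L * (1 - q) ^ 3) = 2 * (1 - q) ^ 5 / A"
    by (simp add: L_def eval_nat_numeral)
  ultimately show ?thesis by simp
qed

section \<open>Number of traces for large \<open>n\<close>\<close>

lemma drift_x_string_le: "drift (x_string (Suc m)) \<le> 6 / (1 - q) + 4"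
  and drift_y_string_le: "drift (y_string (Suc m)) \<le> 6 / (1 - q) + 4"
proof -
  have tail: "drift (alternating m) \<le> 3 / (1 - q)"
    using drift_alternating_le[of m "[]"] by simp
  \<comment> \<open>Each flank costs at most \<open>3 / (1 - q)\<close> and each bit of the block at
    most 1.\<close>
  have "drift (alternating m @ [a, b, c, d] @ alternating m) \<le> 6 / (1 - q) + 4" for a b c d
    using drift_alternating_le[of m "[a, b, c, d] @ alternating m"] tail
      abs_next_agree_le[of a "[b, c, d] @ alternating m"] abs_next_agree_le[of b "[c, d] @ alternating m"]
      abs_next_agree_le[of c "[d] @ alternating m"] abs_next_agree_le[of d "alternating m"]
    by simp
  then show "drift (x_string (Suc m)) \<le> 6 / (1 - q) + 4" "drift (y_string (Suc m)) \<le> 6 / (1 - q) + 4"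
    unfolding x_string_Suc y_string_Suc by blast+
qed

text \<open>With \<open>A\<close> of order \<open>sqrt n\<close> the second moment is
  \<open>O(A)\<close> and the gap between the means is at least a constant times
  \<open>1 / A\<close>, so the required number of traces per \<open>ln (1 / \<epsilon>)\<close> is
  of order \<open>A ^ 3\<close>, that is, \<open>n powr (3 / 2)\<close>.\<close>

lemma eventually_distinguishable:
  "\<exists>C>0. eventually (\<lambda>n. \<forall>\<epsilon> T. 0 < \<epsilon> \<longrightarrow> \<epsilon> < 1 \<longrightarrow> real T \<ge> C * ln (1 / \<epsilon>) * real n powr (3 / 2) \<longrightarrow>
     distinguishable q \<epsilon> T (x_string n) (y_string n)) sequentially"
proof -
  define Z where "Z = (\<Sum>e. q ^ e * (real (Suc e) * (1 + (real (Suc e))\<^sup>2)))"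
  \<comment> \<open>With \<open>A\<^sup>2 = K * s\<close> the ratio
    \<open>12 * s / A\<^sup>2\<close> is exactly the largest value that
    \<open>E_stat_diff_ge\<close> admits.\<close>
  define K where "K = 12 * ((Z + 42) / (1 - q) ^ 3)"
  define D where "D = 6 / (1 - q) + 5"
  \<comment> \<open>From \<open>16 * V / \<delta>\<^sup>2\<close> with
    \<open>V = (1 + 2 * D) * (5 * A)\<close> and \<open>\<delta> = 2 * (1 - q) ^ 5 / A\<close>,
    after bounding \<open>A ^ 3\<close> by \<open>(2 * K * n) powr (3 / 2)\<close>.\<close>
  define C where "C = 20 * (1 + 2 * D) * (2 * K) powr (3 / 2) / (1 - q) ^ 10"
  have Z: "Z \<ge> 0" unfolding Z_def using q0 by (intro suminf_nonneg summable_cubic) auto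
  have K: "K \<ge> 2"
  proof -
    have "(1 - q) ^ 3 \<le> 1" using q0 q1 by (intro power_le_one) auto
    then have "2 * (1 - q) ^ 3 \<le> 12 * (Z + 42)" using Z by simp
    then show ?thesis using q1 by (simp add: K_def pos_le_divide_eq)
  qed
  have D: "D \<ge> 0" using q1 by (simp add: D_def)
  have C: "C > 0" using K D q1 by (simp add: C_def)
  have main: "distinguishable q \<epsilon> T (x_string (Suc m)) (y_string (Suc m))"
    if m: "m \<ge> 1" and moment: "(\<Sum>e<2 * m. (- q) ^ e * real (Suc e)) \<ge> 0"
      and \<epsilon>: "0 < \<epsilon>" "\<epsilon> < 1" and T: "real T \<ge> C * ln (1 / \<epsilon>) * real (Suc m) powr (3 / 2)" for m \<epsilon> T
  proof -
    define A where "A = sqrt (K * real (2 * m))"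
    define f where "f = weight (real (2 * m) * (1 - q)) A"
    have A2: "A\<^sup>2 = K * real (2 * m)" using K by (simp add: A_def)
    have "2\<^sup>2 \<le> K * real (2 * m)" using mult_mono[of 2 K 2 "real (2 * m)"] K m by simp
    then have A: "A \<ge> 2" unfolding A_def by (rule real_le_rsqrt)
    have f: "\<bar>f j\<bar> \<le> 1" for j unfolding f_def using A by (intro abs_weight_le) simp
    have sum_f: "(\<Sum>j = 0..<n. \<bar>f j\<bar>) \<le> 5 * A" for n
      using sum_abs_weight_le[of A "real (2 * m) * (1 - q)" n] A by (simp add: f_def atLeast0LessThan)
    have var: "E z (\<lambda>t. (stat f 0 t)\<^sup>2) \<le> (1 + 2 * D) * (5 * A)" if "drift z + 1 \<le> D" for z
    proof -
      have "E z (\<lambda>t. (stat f 0 t)\<^sup>2) \<le> (1 + 2 * D) * (\<Sum>j = 0..<0 + length z. \<bar>f j\<bar>)"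
        using f that by (rule E_stat_sq_le)
      also have "\<dots> \<le> (1 + 2 * D) * (5 * A)" using D sum_f by (intro mult_left_mono) auto
      finally show ?thesis .
    qed
    show ?thesis
    proof (rule distinguishable_of_statistic)
      show "length (x_string (Suc m)) = length (y_string (Suc m))"
        by (simp add: length_x_string length_y_string)
      show "\<bar>stat f 0 t\<bar> \<le> 5 * A" for t
        using abs_stat_le[of f 0 t] sum_f[of "length t"] by simp
      show "E (x_string (Suc m)) (\<lambda>t. (stat f 0 t)\<^sup>2) \<le> (1 + 2 * D) * (5 * A)"
        "E (y_string (Suc m)) (\<lambda>t. (stat f 0 t)\<^sup>2) \<le> (1 + 2 * D) * (5 * A)"
        using drift_x_string_le[of m] drift_y_string_le[of m]
        by (intro var, simp add: D_def)+
      show "2 * (1 - q) ^ 5 / A \<le> E (x_string (Suc m)) (stat f 0) - E (y_string (Suc m)) (stat f 0)"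
        unfolding x_string_Suc y_string_Suc
      proof (rule E_stat_diff_ge)
        show "12 * real (2 * m) / A\<^sup>2 \<le>
            (1 - q) ^ 3 / ((\<Sum>e. q ^ e * (real (Suc e) * (1 + (real (Suc e))\<^sup>2))) + 42)"
        proof -
          have "12 * real (2 * m) / A\<^sup>2 = 12 / K" unfolding A2 using m K by simp
          moreover have "12 / (12 * x) = 1 / x" for x :: real by simp
          then have "12 / K = 1 / ((Z + 42) / (1 - q) ^ 3)" unfolding K_def .
          ultimately have "12 * real (2 * m) / A\<^sup>2 = (1 - q) ^ 3 / (Z + 42)" by simp
          then show ?thesis by (simp only: Z_def order_refl)
        qed
        show "\<bar>A * (f j - f (Suc j)) - 1\<bar> \<le> 12 * (real j - real (2 * m) * (1 - q))\<^sup>2 / A\<^sup>2" for j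
          unfolding f_def using A by (rule weight_step)
      qed (use A m moment in auto)
      show "2 * (1 - q) ^ 5 / A * (5 * A) \<le> 2 * ((1 + 2 * D) * (5 * A))"
      proof -
        have "2 * (1 - q) ^ 5 / A * (5 * A) = 10 * (1 - q) ^ 5" using A by simp
        also have "\<dots> \<le> 10 * 1" using q0 q1 by (intro mult_left_mono power_le_one) auto
        also have "\<dots> \<le> 2 * (1 * (5 * A))" using A by simp
        also have "\<dots> \<le> 2 * ((1 + 2 * D) * (5 * A))"
          using A D by (intro mult_left_mono mult_right_mono) auto
        finally show ?thesis .
      qed
      have "A ^ 3 = (K * real (2 * m)) powr (3 / 2)"
        unfolding A_def using K m by (simp add: powr_half_sqrt[symmetric] powr_powr flip: powr_numeral)
      also have "\<dots> \<le> (2 * K * real (Suc m)) powr (3 / 2)"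
        using K by (intro powr_mono2) auto
      also have "\<dots> = (2 * K) powr (3 / 2) * real (Suc m) powr (3 / 2)"
        using K by (simp add: powr_mult)
      finally have A3: "A ^ 3 \<le> (2 * K) powr (3 / 2) * real (Suc m) powr (3 / 2)" .
      have "16 * ((1 + 2 * D) * (5 * A)) / (2 * (1 - q) ^ 5 / A)\<^sup>2 = 20 * (1 + 2 * D) / (1 - q) ^ 10 * A ^ 3"
        using A by (simp add: power_divide power_mult_distrib power2_eq_square power3_eq_cube flip: power_mult)
      also have "\<dots> \<le> 20 * (1 + 2 * D) / (1 - q) ^ 10 * ((2 * K) powr (3 / 2) * real (Suc m) powr (3 / 2))"
        using A3 D q1 by (intro mult_left_mono) auto
      also have "\<dots> = C * real (Suc m) powr (3 / 2)" by (simp add: C_def)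
      finally have "16 * ((1 + 2 * D) * (5 * A)) / (2 * (1 - q) ^ 5 / A)\<^sup>2 * ln (1 / \<epsilon>)
          \<le> C * real (Suc m) powr (3 / 2) * ln (1 / \<epsilon>)"
        using \<epsilon> by (intro mult_right_mono) auto
      also have "\<dots> \<le> real T" using T by (simp add: mult_ac)
      finally show "16 * ((1 + 2 * D) * (5 * A)) / (2 * (1 - q) ^ 5 / A)\<^sup>2 * ln (1 / \<epsilon>) \<le> real T" .
    qed (use A D q1 \<epsilon> in auto)
  qed
  define P where "P n \<longleftrightarrow> (\<forall>\<epsilon> T. 0 < \<epsilon> \<longrightarrow> \<epsilon> < 1 \<longrightarrow>
    real T \<ge> C * ln (1 / \<epsilon>) * real n powr (3 / 2) \<longrightarrow>
    distinguishable q \<epsilon> T (x_string n) (y_string n))" for n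
  have "eventually (\<lambda>m. P (Suc m)) sequentially"
    using eventually_alternating_moment_nonneg eventually_ge_at_top[of 1]
    by eventually_elim (use main in \<open>auto simp: P_def\<close>)
  then have "eventually P sequentially"
    by (simp only: eventually_sequentially_Suc)
  then show ?thesis using C unfolding P_def by blast
qed

end

section \<open>One constant for all \<open>n \<ge> 2\<close>\<close>

theorem proposition1p2:
  fixes q :: real
  assumes "0 < q" and "q < 1"
  shows "\<exists>C::real. C > 0 \<and>
    (\<forall>\<epsilon>::real. \<forall>n::nat. 0 < \<epsilon> \<longrightarrow> \<epsilon> < 1 / 2 \<longrightarrow> n \<ge> 2 \<longrightarrow>
       distinguishable q \<epsilon>
         (nat \<lceil>C * ln (1 / \<epsilon>) * real n powr (3 / 2) * ln (real n)\<rceil>)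
         (x_string n) (y_string n))"
proof -
  interpret deletion q by standard (use assms in auto)
  obtain C\<^sub>1 N where C1: "C\<^sub>1 > 0"
    and large: "\<And>n \<epsilon> T. n \<ge> N \<Longrightarrow> 0 < \<epsilon> \<Longrightarrow> \<epsilon> < 1 \<Longrightarrow>
      real T \<ge> C\<^sub>1 * ln (1 / \<epsilon>) * real n powr (3 / 2) \<Longrightarrow>
      distinguishable q \<epsilon> T (x_string n) (y_string n)"
    using eventually_distinguishable unfolding eventually_sequentially by blast
  have "\<exists>D>0. \<forall>\<epsilon> T. 0 < \<epsilon> \<longrightarrow> real T \<ge> D * ln (1 / \<epsilon>) \<longrightarrow>
      distinguishable q \<epsilon> T (x_string (Suc m)) (y_string (Suc m))" for m
    using assms x_string_neq_y_string[of "Suc m"]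
    by (intro ex_statistic_sample_bound) (auto simp: length_x_string length_y_string)
  then obtain D where D: "\<And>m. D m > 0"
    and small: "\<And>m \<epsilon> T. 0 < \<epsilon> \<Longrightarrow> real T \<ge> D m * ln (1 / \<epsilon>) \<Longrightarrow>
      distinguishable q \<epsilon> T (x_string (Suc m)) (y_string (Suc m))"
    by metis
  \<comment> \<open>Dominates \<open>C\<^sub>1\<close> as well as each of the finitely many
    constants \<open>D m\<close> for \<open>n < N\<close>.\<close>
  define B where "B = C\<^sub>1 + (\<Sum>m<N. D m)"
  \<comment> \<open>Division by \<open>ln 2\<close> is offset by \<open>ln n \<ge> ln 2\<close>,
    valid for \<open>n \<ge> 2\<close>.\<close>
  define C where "C = B / ln 2"
  have sumD: "(\<Sum>m<N. D m) \<ge> 0" using D by (intro sum_nonneg) (auto intro: less_imp_le)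
  have B: "B > 0" using C1 sumD by (simp add: B_def)
  show ?thesis
  proof (intro exI[of _ C] conjI allI impI)
    show "C > 0" using B by (simp add: C_def)
    fix \<epsilon> :: real and n :: nat
    assume \<epsilon>: "0 < \<epsilon>" "\<epsilon> < 1 / 2" and n: "n \<ge> 2"
    define T where "T = nat \<lceil>C * ln (1 / \<epsilon>) * real n powr (3 / 2) * ln (real n)\<rceil>"
    have l: "ln (1 / \<epsilon>) \<ge> 0" using \<epsilon> by simp
    have "B * ln (1 / \<epsilon>) * real n powr (3 / 2) = C * ln (1 / \<epsilon>) * real n powr (3 / 2) * ln 2"
      by (simp add: C_def)
    also have "\<dots> \<le> C * ln (1 / \<epsilon>) * real n powr (3 / 2) * ln (real n)"
      using n l B by (intro mult_left_mono) (auto simp: C_def)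
    also have "\<dots> \<le> real T" unfolding T_def by (rule real_nat_ceiling_ge)
    finally have T: "B * ln (1 / \<epsilon>) * real n powr (3 / 2) \<le> real T" .
    have "distinguishable q \<epsilon> T (x_string n) (y_string n)"
    proof (cases "n \<ge> N")
      case True
      have "C\<^sub>1 * ln (1 / \<epsilon>) * real n powr (3 / 2) \<le> B * ln (1 / \<epsilon>) * real n powr (3 / 2)"
        using sumD l by (intro mult_right_mono) (auto simp: B_def)
      also note T
      finally show ?thesis using True \<epsilon> by (intro large) auto
    next
      case False
      obtain m where m: "n = Suc m" using n by (cases n) auto
      have "D m \<le> (\<Sum>m<N. D m)"
        using False m D by (intro member_le_sum) (auto intro: less_imp_le)
      then have "D m \<le> B" using C1 by (simp add: B_def)
      then have "D m * ln (1 / \<epsilon>) \<le> B * ln (1 / \<epsilon>) * 1" using l by (simp add: mult_right_mono)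
      also have "\<dots> \<le> B * ln (1 / \<epsilon>) * real n powr (3 / 2)"
        using n l B by (intro mult_left_mono ge_one_powr_ge_zero) auto
      also note T
      finally show ?thesis unfolding m using \<epsilon> by (intro small) auto
    qed
    then show "distinguishable q \<epsilon>
        (nat \<lceil>C * ln (1 / \<epsilon>) * real n powr (3 / 2) * ln (real n)\<rceil>) (x_string n) (y_string n)"
      by (simp only: T_def)
  qed
qed

end
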